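(* Let $M$ be a paracompact, locally compact, Hausdorff topological space, let $\Gamma$ be a group acting on $M$ by homeomorphisms, and consider the induced action of $\Gamma$ on the compact space $2^M$ of closed subsets of $M$ (with the Chabauty topology). Let $\mathcal{Y}$ be a minimal, closed, $\Gamma$-invariant subset of $2^M$. Then all elements of $\mathcal{Y}$ are compact subsets of $M$ if and only if the union $\bigcup \mathcal{Y} \subseteq M$ has compact closure in $M$.
   Context: For a locally compact Hausdorff space $M$, $2^M$ denotes the set of all closed subsets of $M$ (including $\emptyset$), with the Chabauty (Fell) topology, i.e. the topology with subbasis consisting of the sets $\{A\in 2^M : A\cap U\neq\emptyset\}$ for $U\subseteq M$ open and $\{A\in 2^M : A\cap K=\emptyset\}$ for $K\subseteq M$ compact. The space $2^M$ is compact, and an action of $\Gamma$ on $M$ by homeomorphisms induces an action on $2^M$ by homeomorphisms, $A\mapsto gA$. A closed $\Gamma$-invariant subset $\mathcal{Y}\subseteq 2^M$ is minimal if it is non-empty and has no non-empty, proper, closed, $\Gamma$-invariant subset (equivalently, it is non-empty and every $\Gamma$-orbit in $\mathcal{Y}$ is dense in $\mathcal{Y}$). A space is paracompact if every open cover admits a locally finite open refinement, where a cover is locally finite if each point has a neighbourhood meeting only finitely many members of the cover. $\bigcup\mathcal{Y}$ denotes $\{x\in M : x\in Y \text{ for some } Y\in\mathcal{Y}\}$. *)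

theory Defs
  imports "HOL-Analysis.Analysis" "HOL-Algebra.Group_Action"
begin

section \<open>Paracompact spaces\<close>

text \<open>No separation axiom is included.\<close>

definition paracompact_space :: "'a topology \<Rightarrow> bool"
  where "paracompact_space X \<longleftrightarrow>
    (\<forall>\<U>. (\<forall>U\<in>\<U>. openin X U) \<and> \<Union>\<U> = topspace X \<longrightarrow>
      (\<exists>\<V>. (\<forall>V\<in>\<V>. openin X V) \<and> \<Union>\<V> = topspace X \<and>
            (\<forall>V\<in>\<V>. \<exists>U\<in>\<U>. V \<subseteq> U) \<and> locally_finite_in X \<V>))"

section \<open>The Chabauty topology\<close>

definition chabauty :: "'a topology \<Rightarrow> 'a set topology"
  where "chabauty M = topology_generated_by
    ({{A. closedin M A \<and> A \<inter> U \<noteq> {}} | U. openin M U} \<union>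
     {{A. closedin M A \<and> A \<inter> K = {}} | K. compactin M K})"

lemma topspace_chabauty: "topspace (chabauty M) = {A. closedin M A}"
proof -
  have "{A. closedin M A} = {A. closedin M A \<and> A \<inter> {} = {}}"
    by simp
  then have "{A. closedin M A} \<in> {{A. closedin M A \<and> A \<inter> K = {}} | K. compactin M K}"
    using compactin_empty by blast
  then show ?thesis
    unfolding chabauty_def topology_generated_by_topspace by blast
qed

section \<open>Actions by homeomorphisms\<close>

text \<open>The acting group carries no topology.\<close>

locale homeomorphic_action = group_action G "topspace X" \<phi>
  for G (structure) and X and \<phi> +
  assumes homeomorphic_map_action: "g \<in> carrier G \<Longrightarrow> homeomorphic_map X X (\<phi> g)"

definition invariant_under :: "('g, 'z) monoid_scheme \<Rightarrow> ('g \<Rightarrow> 'a \<Rightarrow> 'a) \<Rightarrow> 'a set \<Rightarrow> bool"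
  where "invariant_under G \<phi> S \<longleftrightarrow> (\<forall>g\<in>carrier G. \<phi> g ` S \<subseteq> S)"

definition minimal_closed_invariant ::
    "('g, 'z) monoid_scheme \<Rightarrow> 'a topology \<Rightarrow> ('g \<Rightarrow> 'a \<Rightarrow> 'a) \<Rightarrow> 'a set \<Rightarrow> bool"
  where "minimal_closed_invariant G X \<phi> S \<longleftrightarrow>
    closedin X S \<and> invariant_under G \<phi> S \<and> S \<noteq> {} \<and>
    \<not> (\<exists>T. T \<subset> S \<and> T \<noteq> {} \<and> closedin X T \<and> invariant_under G \<phi> T)"

text \<open>Restricted to the closed sets because \<^const>\<open>BijGroup\<close> consists of extensional functions.\<close>

definition induced_action :: "'a topology \<Rightarrow> ('g \<Rightarrow> 'a \<Rightarrow> 'a) \<Rightarrow> 'g \<Rightarrow> 'a set \<Rightarrow> 'a set"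
  where "induced_action M \<phi> g = (\<lambda>A\<in>topspace (chabauty M). \<phi> g ` A)"

context homeomorphic_action
begin

lemma action_closedin:
  assumes "g \<in> carrier G" "closedin X A"
  shows "closedin X (\<phi> g ` A)"
  using homeomorphic_map_closedness_eq homeomorphic_map_action assms by blast

lemma action_inverse:
  assumes "g \<in> carrier G" "x \<in> topspace X"
  shows "\<phi> (inv g) (\<phi> g x) = x" "\<phi> g (\<phi> (inv g) x) = x"
proof -
  interpret group G
    using group_hom by (simp add: group_hom_def)
  show "\<phi> (inv g) (\<phi> g x) = x"
    by (rule orbit_sym_aux[OF assms refl])
  show "\<phi> g (\<phi> (inv g) x) = x"
    using orbit_sym_aux[OF inv_closed[OF assms(1)] assms(2) refl] inv_inv[OF assms(1)] by simp
qed

lemma induced_continuous: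
  assumes g: "g \<in> carrier G"
  shows "continuous_map (chabauty X) (chabauty X) (induced_action X \<phi> g)"
proof -
  have gi: "inv g \<in> carrier G"
    using g group_hom by (simp add: group_hom_def)
  have meet: "\<phi> g ` A \<inter> B = {} \<longleftrightarrow> A \<inter> \<phi> (inv g) ` B = {}"
    if "A \<subseteq> topspace X" "B \<subseteq> topspace X" for A B
  proof -
    have "\<phi> (inv g) (\<phi> g a) = a" if "a \<in> A" for a
      using action_inverse(1)[OF g] that \<open>A \<subseteq> topspace X\<close> by blast
    moreover have "\<phi> g (\<phi> (inv g) b) = b" if "b \<in> B" for b
      using action_inverse(2)[OF g] that \<open>B \<subseteq> topspace X\<close> by blast
    ultimately show ?thesis
      unfolding disjoint_iff image_iff by metis
  qed
  have sub: "A \<subseteq> topspace X" if "closedin X A" for A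
    using that by (rule closedin_subset)
  show ?thesis
    unfolding chabauty_def[of X]
  proof (rule continuous_on_generated_topo, goal_cases)
    case (1 S)
    then consider U where "openin X U" "S = {A. closedin X A \<and> A \<inter> U \<noteq> {}}"
      | K where "compactin X K" "S = {A. closedin X A \<and> A \<inter> K = {}}"
      by blast
    then have "openin (chabauty X) (induced_action X \<phi> g -` S \<inter> topspace (chabauty X))"
    proof cases
      case (1 U)
      have "openin X (\<phi> (inv g) ` U)"
        using homeomorphic_map_action[OF gi] 1 homeomorphic_map_openness_eq by blast
      moreover have "induced_action X \<phi> g -` S \<inter> topspace (chabauty X)
          = {A. closedin X A \<and> A \<inter> \<phi> (inv g) ` U \<noteq> {}}"
        using 1 meet[OF sub openin_subset[OF 1(1)]] action_closedin[OF g]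
        by (auto simp: induced_action_def topspace_chabauty)
      ultimately show ?thesis
        unfolding chabauty_def by (intro topology_generated_by_Basis) auto
    next
      case (2 K)
      have "compactin X (\<phi> (inv g) ` K)"
        using homeomorphic_map_action[OF gi] 2 homeomorphic_imp_continuous_map image_compactin by blast
      moreover have "induced_action X \<phi> g -` S \<inter> topspace (chabauty X)
          = {A. closedin X A \<and> A \<inter> \<phi> (inv g) ` K = {}}"
        using 2 meet[OF sub compactin_subset_topspace[OF 2(1)]] action_closedin[OF g]
        by (auto simp: induced_action_def topspace_chabauty)
      ultimately show ?thesis
        unfolding chabauty_def by (intro topology_generated_by_Basis) auto
    qed
    then show ?case
      by (simp add: chabauty_def)
  next
    case 2
    show ?case
      using topspace_chabauty[of X] action_closedin[OF g]
      unfolding topology_generated_by_topspace[symmetric] chabauty_def[symmetric]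
      by (auto simp: induced_action_def)
  qed
qed

lemma induced_inverse:
  assumes g: "g \<in> carrier G" and A: "closedin X A"
  shows "induced_action X \<phi> (inv g) (induced_action X \<phi> g A) = A"
    and "induced_action X \<phi> g (induced_action X \<phi> (inv g) A) = A"
proof -
  have gi: "inv g \<in> carrier G"
    using g group_hom by (simp add: group_hom_def)
  have "a \<in> topspace X" if "a \<in> A" for a
    using closedin_subset[OF A] that by blast
  then have "\<phi> (inv g) ` \<phi> g ` A = A" "\<phi> g ` \<phi> (inv g) ` A = A"
    using action_inverse[OF g] by (force simp: image_iff)+
  then show "induced_action X \<phi> (inv g) (induced_action X \<phi> g A) = A"
    "induced_action X \<phi> g (induced_action X \<phi> (inv g) A) = A"
    using A action_closedin g gi by (simp_all add: induced_action_def topspace_chabauty)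
qed

lemma induced_homeomorphic:
  assumes g: "g \<in> carrier G"
  shows "homeomorphic_map (chabauty X) (chabauty X) (induced_action X \<phi> g)"
proof -
  have gi: "inv g \<in> carrier G"
    using g group_hom by (simp add: group_hom_def)
  show ?thesis
    unfolding homeomorphic_map_maps homeomorphic_maps_def
    using induced_continuous[OF g] induced_continuous[OF gi] induced_inverse[OF g]
    by (auto simp: topspace_chabauty)
qed

lemma induced_bij:
  assumes "g \<in> carrier G"
  shows "induced_action X \<phi> g \<in> Bij (topspace (chabauty X))"
  using induced_homeomorphic[OF assms]
  by (auto simp: Bij_def bij_betw_def homeomorphic_eq_everything_map induced_action_def)

lemma induced_homeomorphic_action:
  "homeomorphic_action G (chabauty X) (induced_action X \<phi>)"
proof -
  have G: "group G"
    using group_hom by (simp add: group_hom_def)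
  have "induced_action X \<phi> (g \<otimes> h)
      = compose (topspace (chabauty X)) (induced_action X \<phi> g) (induced_action X \<phi> h)"
    if gh: "g \<in> carrier G" "h \<in> carrier G" for g h
  proof
    fix A
    show "induced_action X \<phi> (g \<otimes> h) A
      = compose (topspace (chabauty X)) (induced_action X \<phi> g) (induced_action X \<phi> h) A"
    proof (cases "closedin X A")
      case True
      then have "\<phi> (g \<otimes> h) a = \<phi> g (\<phi> h a)" if "a \<in> A" for a
        using closedin_subset[OF True] that gh composition_rule by blast
      then show ?thesis
        using True gh action_closedin
        by (auto simp: induced_action_def topspace_chabauty compose_def image_image)
    next
      case False
      then show ?thesis
        by (simp add: induced_action_def topspace_chabauty compose_def)
    qed
  qed
  then have "group_action G (topspace (chabauty X)) (induced_action X \<phi>)"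
    using G induced_bij group_BijGroup
    by (auto simp: group_action_def group_hom_def group_hom_axioms_def hom_def BijGroup_def)
  then show ?thesis
    using induced_homeomorphic
    by (simp add: homeomorphic_action_def homeomorphic_action_axioms_def)
qed

end

end

theory Submission
  imports Defs
begin

text \<open>
  Let all members of \<open>\<Y>\<close> be compact, and let \<open>\<V>\<close> be a locally finite cover of \<open>M\<close> by relatively
  compact open sets; every compact set meets only finitely many members of \<open>\<V>\<close>. Some non-empty
  relatively open \<open>W \<subseteq> \<Y>\<close> has all its members inside one compact set. Otherwise one could choose
  distinct \<open>V\<^sub>0, V\<^sub>1, \<dots>\<close> in \<open>\<V>\<close> and compact sets \<open>L\<^sub>n \<subseteq> V\<^sub>n\<close> such that for each \<open>n\<close> some member of
  \<open>\<Y>\<close> meets all of \<open>L\<^sub>0, \<dots>, L\<^sub>n\<close>; as meeting a compact set is a closed condition, compactness of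
  \<open>\<Y>\<close> would give a single member meeting every \<open>V\<^sub>n\<close>. By minimality and compactness, finitely many
  translates of \<open>W\<close> cover \<open>\<Y>\<close>, so \<open>\<Union>\<Y>\<close> lies in a finite union of translates of a compact set.
\<close>

section \<open>Compactness of the Chabauty space\<close>

text \<open>Needed because \<open>Alexander_subbase\<close> speaks of the left-hand form, while
  \<open>chabauty\<close> is built with \<open>topology_generated_by\<close>. Each side is the
  coarsest topology on \<open>\<Union>\<B>\<close> in which all members of \<open>\<B>\<close> are
  open.\<close>

lemma topology_generated_by_eq_subbase:
  "topology (arbitrary union_of (finite intersection_of (\<lambda>S. S \<in> \<B>) relative_to \<Union>\<B>))
    = topology_generated_by \<B>" (is "?T = _")
proof -
  have *: "openin ?T S" if "S \<in> \<B>" for S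
  proof -
    have "(finite intersection_of (\<lambda>S. S \<in> \<B>) relative_to \<Union>\<B>) S"
      unfolding relative_to_def using that finite_intersection_of_inc
      by (metis Sup_upper inf.absorb2)
    then show ?thesis
      unfolding openin_subbase by (rule arbitrary_union_of_inc)
  qed
  have **: "openin (topology_generated_by \<B>) (\<Union>\<B>)"
    by (metis openin_topspace topology_generated_by_topspace)
  show ?thesis
    unfolding topology_eq
  proof (intro allI iffI)
    fix S
    assume "openin ?T S"
    then show "openin (topology_generated_by \<B>) S"
      using minimal_topology_subbase[OF _ **] topology_generated_by_Basis by metis
  next
    fix S
    assume "openin (topology_generated_by \<B>) S"
    then have "generate_topology_on \<B> S"
      by (rule openin_topology_generated_by)
    then show "openin ?T S"
      using generate_topology_on_coarsest[OF istopology_openin *] by blast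
  qed
qed

lemma openin_chabauty_hit:
  "openin M U \<Longrightarrow> openin (chabauty M) {A. closedin M A \<and> A \<inter> U \<noteq> {}}"
  unfolding chabauty_def by (rule topology_generated_by_Basis) blast

lemma openin_chabauty_miss:
  "compactin M K \<Longrightarrow> openin (chabauty M) {A. closedin M A \<and> A \<inter> K = {}}"
  unfolding chabauty_def by (rule topology_generated_by_Basis) blast

lemma closedin_chabauty_hit:
  assumes "compactin M K"
  shows "closedin (chabauty M) {A. closedin M A \<and> A \<inter> K \<noteq> {}}"
proof -
  have "topspace (chabauty M) - {A. closedin M A \<and> A \<inter> K \<noteq> {}} = {A. closedin M A \<and> A \<inter> K = {}}"
    by (auto simp: topspace_chabauty)
  then show ?thesis
    using openin_chabauty_miss[OF assms] by (auto simp: closedin_def topspace_chabauty)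
qed

text \<open>By Alexander's lemma, covers by subbasic sets suffice. The complement \<open>A\<close>
  of all \<open>U\<close> whose hit sets occur in the cover is itself a closed set, and only a miss
  set, say of \<open>K\<close>, can contain it. Then those \<open>U\<close> cover \<open>K\<close>,
  and finitely many of them do.\<close>

lemma compact_space_chabauty: "compact_space (chabauty M)"
proof -
  let ?hit = "\<lambda>U. {A. closedin M A \<and> A \<inter> U \<noteq> {}}"
  let ?miss = "\<lambda>K. {A. closedin M A \<and> A \<inter> K = {}}"
  let ?B = "{?hit U | U. openin M U} \<union> {?miss K | K. compactin M K}"
  have "\<exists>\<C>'. finite \<C>' \<and> \<C>' \<subseteq> \<C> \<and> \<Union>\<C>' = topspace (chabauty M)"
    if sub: "\<C> \<subseteq> ?B" and cover: "\<Union>\<C> = topspace (chabauty M)" for \<C>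
  proof -
    define \<U> where "\<U> = {U. openin M U \<and> ?hit U \<in> \<C>}"
    define A where "A = topspace M - \<Union>\<U>"
    have A: "closedin M A"
      by (auto simp: A_def \<U>_def)
    then obtain C where C: "C \<in> \<C>" "A \<in> C"
      using cover by (auto simp: topspace_chabauty)
    moreover have "A \<notin> ?hit U" if "U \<in> \<U>" for U
      using that by (auto simp: A_def)
    ultimately have "C \<notin> {?hit U | U. openin M U}"
      by (auto simp: \<U>_def)
    then have "C \<in> {?miss K | K. compactin M K}"
      using sub C(1) by blast
    then obtain K where K: "compactin M K" "C = ?miss K"
      by blast
    then have "A \<inter> K = {}"
      using C(2) by blast
    then have "K \<subseteq> \<Union>\<U>"
      using compactin_subset_topspace[OF K(1)] by (auto simp: A_def)
    then obtain \<F> where \<F>: "finite \<F>" "\<F> \<subseteq> \<U>" "K \<subseteq> \<Union>\<F>"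
      using compactinD[OF K(1)] by (metis (no_types, lifting) \<U>_def mem_Collect_eq)
    define \<C>' where "\<C>' = insert C (?hit ` \<F>)"
    have "\<C>' \<subseteq> \<C>"
      using C \<F> by (auto simp: \<C>'_def \<U>_def)
    \<comment> \<open>A closed set missing \<open>K\<close> lies in \<open>C\<close>; any other one
      meets \<open>K\<close>, hence some member of \<open>\<F>\<close>.\<close>
    moreover have "topspace (chabauty M) \<subseteq> \<Union>\<C>'"
      using K(2) \<F>(3) by (auto simp: \<C>'_def topspace_chabauty)
    moreover have "finite \<C>'"
      using \<F>(1) by (simp add: \<C>'_def)
    ultimately show ?thesis
      using cover by (metis Union_mono subset_antisym)
  qed
  then show ?thesis
    using Alexander_subbase[OF topology_generated_by_eq_subbase, of ?B]
    by (simp flip: chabauty_def)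
qed

section \<open>Locally finite covers\<close>

lemma compactin_meets_finitely_many:
  assumes "locally_finite_in X \<V>" "compactin X K"
  shows "finite {V \<in> \<V>. V \<inter> K \<noteq> {}}"
proof -
  define \<N> where "\<N> = {N. openin X N \<and> finite {V \<in> \<V>. V \<inter> N \<noteq> {}}}"
  have "K \<subseteq> \<Union>\<N>"
    using assms compactin_subset_topspace[OF assms(2)] unfolding locally_finite_in_def \<N>_def by blast
  then obtain \<F> where \<F>: "finite \<F>" "\<F> \<subseteq> \<N>" "K \<subseteq> \<Union>\<F>"
    using compactinD[OF assms(2)] by (metis (no_types, lifting) \<N>_def mem_Collect_eq)
  have "finite (\<Union>N\<in>\<F>. {V \<in> \<V>. V \<inter> N \<noteq> {}})"
    using \<F> by (auto simp: \<N>_def)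
  then show ?thesis
    by (rule rev_finite_subset) (use \<F>(3) in blast)
qed

text \<open>Local compactness provides a cover by open sets lying in compact ones; a refinement
  inherits this property.\<close>

lemma paracompact_relatively_compact_cover:
  assumes "paracompact_space X" "locally_compact_space X"
  obtains \<V> where "\<And>V. V \<in> \<V> \<Longrightarrow> openin X V" "\<Union>\<V> = topspace X" "locally_finite_in X \<V>"
    "\<And>V. V \<in> \<V> \<Longrightarrow> \<exists>K. compactin X K \<and> V \<subseteq> K"
proof -
  define \<U> where "\<U> = {U. openin X U \<and> (\<exists>K. compactin X K \<and> U \<subseteq> K)}"
  have "\<Union>\<U> = topspace X"
  proof
    show "\<Union>\<U> \<subseteq> topspace X"
      using openin_subset by (auto simp: \<U>_def)
    show "topspace X \<subseteq> \<Union>\<U>"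
    proof
      fix x
      assume "x \<in> topspace X"
      then obtain U K where "openin X U" "compactin X K" "x \<in> U" "U \<subseteq> K"
        using assms(2) unfolding locally_compact_space_def by meson
      then show "x \<in> \<Union>\<U>"
        unfolding \<U>_def by (intro UnionI[of U]) blast+
    qed
  qed
  then obtain \<V> where \<V>: "\<forall>V\<in>\<V>. openin X V" "\<Union>\<V> = topspace X" "\<forall>V\<in>\<V>. \<exists>U\<in>\<U>. V \<subseteq> U"
      "locally_finite_in X \<V>"
    using assms(1)[unfolded paracompact_space_def, rule_format, of \<U>] by (auto simp: \<U>_def)
  have rc: "\<exists>K. compactin X K \<and> V \<subseteq> K" if V: "V \<in> \<V>" for V
  proof -
    obtain U where "U \<in> \<U>" "V \<subseteq> U"
      using bspec[OF \<V>(3) V] by blast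
    moreover from this obtain K where "compactin X K" "U \<subseteq> K"
      unfolding \<U>_def by blast
    ultimately show ?thesis
      by (meson order_trans)
  qed
  show thesis
    by (rule that[OF bspec[OF \<V>(1)] \<V>(2,4) rc])
qed

section \<open>Minimality and translates of an open set\<close>

text \<open>The points of \<open>S\<close> whose orbit avoids \<open>W\<close> form a closed
  invariant proper subset, empty by minimality. So the preimages of \<open>W\<close> cover the
  compact set \<open>S\<close>.\<close>

lemma (in homeomorphic_action) minimal_covered_by_translates:
  assumes "compact_space X" and min: "minimal_closed_invariant G X \<phi> S"
    and W: "openin X W" "W \<inter> S \<noteq> {}"
  obtains F where "finite F" "F \<subseteq> carrier G" "\<And>x. x \<in> S \<Longrightarrow> \<exists>g\<in>F. \<phi> g x \<in> W"
proof -
  interpret G: group G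
    using group_hom by (simp add: group_hom_def)
  have S: "closedin X S" "invariant_under G \<phi> S"
    and no: "\<And>T. T \<subset> S \<Longrightarrow> T \<noteq> {} \<Longrightarrow> closedin X T \<Longrightarrow> \<not> invariant_under G \<phi> T"
    using min by (auto simp: minimal_closed_invariant_def)
  have SX: "S \<subseteq> topspace X"
    using S(1) by (rule closedin_subset)
  define P where "P g = {x \<in> topspace X. \<phi> g x \<in> W}" for g
  have P: "openin X (P g)" if "g \<in> carrier G" for g
    unfolding P_def
    using homeomorphic_imp_continuous_map[OF homeomorphic_map_action[OF that]] W(1)
    by (rule openin_continuous_map_preimage)
  define T where "T = S - (\<Union>g\<in>carrier G. P g)"
  have "closedin X T"
    unfolding T_def using S(1) P by (intro closedin_diff openin_Union) auto
  moreover have "invariant_under G \<phi> T"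
    unfolding invariant_under_def
  proof clarify
    fix g x
    assume g: "g \<in> carrier G" and x: "x \<in> T"
    then have xX: "x \<in> topspace X" and "\<phi> g x \<in> S"
      using SX S(2) by (auto simp: T_def invariant_under_def)
    moreover have "\<phi> g x \<notin> P h" if h: "h \<in> carrier G" for h
    proof
      assume "\<phi> g x \<in> P h"
      then have "x \<in> P (h \<otimes> g)"
        using composition_rule[OF xX h g] xX by (simp add: P_def)
      then show False
        using x g h by (auto simp: T_def)
    qed
    ultimately show "\<phi> g x \<in> T"
      by (simp add: T_def)
  qed
  moreover have "T \<noteq> S"
  proof -
    obtain x where x: "x \<in> W" "x \<in> S"
      using W(2) by blast
    \<comment> \<open>The unit acts as the identity restricted to \<open>topspace X\<close>, so
      \<open>x\<close> must be known to lie there.\<close>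
    then have "x \<in> P \<one>"
      using id_eq_one SX by (auto simp: P_def) (metis restrict_apply' subsetD)
    then show ?thesis
      using x by (auto simp: T_def)
  qed
  ultimately have "T = {}"
    using no[of T] by (auto simp: T_def)
  then have "S \<subseteq> \<Union>(P ` carrier G)"
    by (auto simp: T_def)
  moreover have "compactin X S"
    using assms(1) S(1) by (rule closedin_compact_space)
  ultimately obtain \<F> where "finite \<F>" "\<F> \<subseteq> P ` carrier G" "S \<subseteq> \<Union>\<F>"
    using compactinD[of X S "P ` carrier G"] P by blast
  then obtain F where F: "finite F" "F \<subseteq> carrier G" "S \<subseteq> \<Union>(P ` F)"
    by (metis finite_subset_image)
  then show thesis
    by (intro that[of F]) (auto simp: P_def)
qed

section \<open>A common compact bound on an open piece of \<open>\<Y>\<close>\<close>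

lemma locally_uniformly_compact:
  assumes M: "paracompact_space M" "locally_compact_space M" "Hausdorff_space M"
    and \<Y>: "closedin (chabauty M) \<Y>" "\<Y> \<noteq> {}" and cpt: "\<And>Y. Y \<in> \<Y> \<Longrightarrow> compactin M Y"
  obtains W K where "openin (chabauty M) W" "W \<inter> \<Y> \<noteq> {}" "compactin M K"
    "\<And>Y. Y \<in> W \<inter> \<Y> \<Longrightarrow> Y \<subseteq> K"
proof -
  obtain \<V> where \<V>: "\<And>V. V \<in> \<V> \<Longrightarrow> openin M V" "\<Union>\<V> = topspace M" "locally_finite_in M \<V>"
      and rc: "\<And>V. V \<in> \<V> \<Longrightarrow> \<exists>K. compactin M K \<and> V \<subseteq> K"
    using paracompact_relatively_compact_cover[OF M(1,2)] by blast
  have \<Y>closed: "closedin M Y" if "Y \<in> \<Y>" for Y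
    using closedin_subset[OF \<Y>(1)] that by (auto simp: topspace_chabauty)
  have nbhd: "\<exists>U L. openin M U \<and> compactin M L \<and> y \<in> U \<and> U \<subseteq> L \<and> L \<subseteq> V"
    if "V \<in> \<V>" "y \<in> V" for y V
    using locally_compact_space_neighbourhood_base[of M] M \<V>(1)[OF that(1)] that(2)
    by (auto simp: neighbourhood_base_of)
  \<comment> \<open>Each \<open>V\<close> comes with two sets: hitting \<open>U\<close> is an open condition, giving \<open>W\<close> at the end; hitting
    \<open>L\<close> is a closed one, so that it survives the passage to the limit.\<close>
  define hits where "hits S Y \<longleftrightarrow> (\<forall>(V, U, L)\<in>S. Y \<inter> U \<noteq> {})"
    for S :: "('a set \<times> 'a set \<times> 'a set) set" and Y :: "'a set"
  define stage where "stage S \<longleftrightarrow> finite S \<and>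
      (\<forall>(V, U, L)\<in>S. V \<in> \<V> \<and> openin M U \<and> compactin M L \<and> U \<subseteq> L \<and> L \<subseteq> V) \<and>
      (\<exists>Y\<in>\<Y>. hits S Y)" for S
  \<comment> \<open>At such a stage every member of \<open>\<Y>\<close> hitting \<open>S\<close> is
    trapped in finitely many relatively compact sets. If there is none, every stage can be extended
    by a new \<open>V\<close>.\<close>
  have "\<exists>S. stage S \<and> (\<forall>Y\<in>\<Y>. hits S Y \<longrightarrow> Y \<subseteq> \<Union>(fst ` S))"
  proof (rule ccontr)
    assume contra: "\<not> ?thesis"
    have step: "\<exists>S'. stage S' \<and> (S \<subseteq> S' \<and> card (fst ` S) < card (fst ` S'))"
      if S: "stage S" for S
    proof -
      obtain Y y where Y: "Y \<in> \<Y>" "hits S Y" and y: "y \<in> Y" "y \<notin> \<Union>(fst ` S)"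
        using contra S by blast
      obtain V where V: "V \<in> \<V>" "y \<in> V"
        using y(1) closedin_subset[OF \<Y>closed[OF Y(1)]] \<V>(2) by blast
      obtain U L where UL: "openin M U" "compactin M L" "y \<in> U" "U \<subseteq> L" "L \<subseteq> V"
        using nbhd[OF V] by blast
      have "stage (insert (V, U, L) S)"
        unfolding stage_def
      proof (intro conjI)
        show "\<exists>Y\<in>\<Y>. hits (insert (V, U, L) S) Y"
          using Y y(1) UL(3) by (intro bexI[of _ Y]) (auto simp: hits_def)
      qed (use S V UL in \<open>auto simp: stage_def\<close>)
      moreover have "V \<notin> fst ` S"
        using y(2) V(2) by blast
      then have "card (fst ` S) < card (fst ` insert (V, U, L) S)"
        using S by (simp add: stage_def)
      ultimately show ?thesis
        by blast
    qed
    have "\<exists>S. \<forall>n. stage (S n) \<and> (S n \<subseteq> S (Suc n) \<and> card (fst ` S n) < card (fst ` S (Suc n)))"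
    proof (rule dependent_nat_choice[where P = "\<lambda>_. stage"])
      show "\<exists>S. stage S"
        using \<Y>(2) by (intro exI[of _ "{}"]) (auto simp: stage_def hits_def)
    qed (rule step)
    then obtain S where S: "\<And>n. stage (S n)" "\<And>n. S n \<subseteq> S (Suc n)"
        "\<And>n. card (fst ` S n) < card (fst ` S (Suc n))"
      by blast
    \<comment> \<open>The closed counterpart of hitting \<open>S n\<close>, with \<open>L\<close> in
      place of \<open>U\<close>. It is non-empty since \<open>U \<subseteq> L\<close>, and
      decreasing since the stages grow.\<close>
    define C where "C n = \<Y> \<inter> (\<Inter>(V, U, L)\<in>S n. {A. closedin M A \<and> A \<inter> L \<noteq> {}})" for n
    have "closedin (chabauty M) (C n)" for n
    proof -
      have "C n = \<Inter>(insert \<Y> ((\<lambda>(V, U, L). {A. closedin M A \<and> A \<inter> L \<noteq> {}}) ` S n))"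
        by (simp add: C_def)
      moreover have "closedin (chabauty M) \<dots>"
        using \<Y>(1) S(1)[of n] by (intro closedin_Inter) (auto simp: stage_def intro: closedin_chabauty_hit)
      ultimately show ?thesis
        by simp
    qed
    moreover have "C n \<noteq> {}" for n
    proof -
      obtain Y where Y: "Y \<in> \<Y>" "hits (S n) Y"
        using S(1)[of n] by (auto simp: stage_def)
      then have "Y \<in> C n"
        using S(1)[of n] \<Y>closed[OF Y(1)] unfolding C_def stage_def hits_def by fast
      then show ?thesis
        by blast
    qed
    moreover have "decseq C"
      using S(2) by (intro decseq_SucI) (auto simp: C_def)
    ultimately have "(\<Inter>n. C n) \<noteq> {}"
      by (intro compact_space_imp_nest[OF compact_space_chabauty]) (auto simp: decseq_def)
    then obtain Y where Y: "\<And>n. Y \<in> C n"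
      by blast
    then have "Y \<in> \<Y>"
      by (auto simp: C_def)
    then have fin: "finite {V \<in> \<V>. V \<inter> Y \<noteq> {}}"
      by (intro compactin_meets_finitely_many[OF \<V>(3)] cpt)
    \<comment> \<open>The limit \<open>Y\<close> meets each \<open>L\<close> of each stage, hence
      the corresponding \<open>V\<close>. As \<open>Y\<close> is compact, this bounds the number of
      distinct \<open>V\<close> in all stages, although that number grows strictly.\<close>
    have "fst ` S n \<subseteq> {V \<in> \<V>. V \<inter> Y \<noteq> {}}" for n
      using S(1)[of n] Y[of n] unfolding stage_def C_def by fastforce
    then have "card (fst ` S n) \<le> card {V \<in> \<V>. V \<inter> Y \<noteq> {}}" for n
      by (intro card_mono fin)
    moreover have "n \<le> card (fst ` S n)" for n
      using S(3) by (intro strict_mono_imp_increasing) (simp add: strict_mono_Suc_iff)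
    ultimately show False
      by (meson not_less_eq_eq order_trans)
  qed
  then obtain S where S: "stage S"
      and sub: "\<And>Y. Y \<in> \<Y> \<Longrightarrow> hits S Y \<Longrightarrow> Y \<subseteq> \<Union>(fst ` S)"
    by blast
  obtain k where k: "\<And>V. V \<in> \<V> \<Longrightarrow> compactin M (k V) \<and> V \<subseteq> k V"
    using rc by metis
  have fstS: "finite (fst ` S)" "fst ` S \<subseteq> \<V>"
    using S by (auto simp: stage_def)
  \<comment> \<open>Inserting the whole space keeps the intersected family non-empty when
    \<open>S\<close> is empty.\<close>
  define W where "W = \<Inter>(insert (topspace (chabauty M))
      ((\<lambda>(V, U, L). {A. closedin M A \<and> A \<inter> U \<noteq> {}}) ` S))"
  show thesis
  proof (rule that)
    show "openin (chabauty M) W"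
      unfolding W_def using S
      by (intro openin_Inter) (auto simp: stage_def intro: openin_chabauty_hit)
    show "W \<inter> \<Y> \<noteq> {}"
    proof -
      obtain Y where "Y \<in> \<Y>" "hits S Y"
        using S by (auto simp: stage_def)
      then have "Y \<in> W \<inter> \<Y>"
        using \<Y>closed by (auto simp: W_def topspace_chabauty hits_def)
      then show ?thesis
        by blast
    qed
    show "compactin M (\<Union>(k ` fst ` S))"
      using fstS k by (intro compactin_Union) auto
    show "Y \<subseteq> \<Union>(k ` fst ` S)" if "Y \<in> W \<inter> \<Y>" for Y
    proof -
      have "Y \<subseteq> \<Union>(fst ` S)"
        using that by (intro sub) (auto simp: W_def hits_def)
      also have "\<dots> \<subseteq> \<Union>(k ` fst ` S)"
        using subsetD[OF fstS(2)] k by (intro Union_least) (meson UN_upper order_trans)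
      finally show ?thesis .
    qed
  qed
qed

theorem theorem1p1:
  fixes M :: "'a topology"
    and \<Gamma> :: "('g, 'z) monoid_scheme"
    and \<phi> :: "'g \<Rightarrow> 'a \<Rightarrow> 'a"
    and \<Y> :: "'a set set"
  assumes "paracompact_space M"
    and "locally_compact_space M"
    and "Hausdorff_space M"
    and "homeomorphic_action \<Gamma> M \<phi>"
    and "minimal_closed_invariant \<Gamma> (chabauty M) (induced_action M \<phi>) \<Y>"
  shows "(\<forall>Y\<in>\<Y>. compactin M Y) \<longleftrightarrow> compactin M (M closure_of (\<Union>\<Y>))"
proof
  interpret homeomorphic_action \<Gamma> M \<phi>
    by fact
  interpret ind: homeomorphic_action \<Gamma> "chabauty M" "induced_action M \<phi>"
    by (rule induced_homeomorphic_action)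
  interpret \<Gamma>: group \<Gamma>
    using group_hom by (simp add: group_hom_def)
  have \<Y>: "closedin (chabauty M) \<Y>" "\<Y> \<noteq> {}"
    using assms(5) by (auto simp: minimal_closed_invariant_def)
  have \<Y>closed: "closedin M Y" if "Y \<in> \<Y>" for Y
    using closedin_subset[OF \<Y>(1)] that by (auto simp: topspace_chabauty)
  {
    assume cpt: "compactin M (M closure_of (\<Union>\<Y>))"
    show "\<forall>Y\<in>\<Y>. compactin M Y"
    proof
      fix Y
      assume Y: "Y \<in> \<Y>"
      have "\<Union>\<Y> \<subseteq> M closure_of (\<Union>\<Y>)"
        using \<Y>closed closedin_subset by (intro closure_of_subset) blast
      then show "compactin M Y"
        using closed_compactin[OF cpt _ \<Y>closed[OF Y]] Y by blast
    qed
  next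
    assume cpt: "\<forall>Y\<in>\<Y>. compactin M Y"
    obtain W K where W: "openin (chabauty M) W" "W \<inter> \<Y> \<noteq> {}" and K: "compactin M K"
        and WK: "\<And>Y. Y \<in> W \<inter> \<Y> \<Longrightarrow> Y \<subseteq> K"
      using locally_uniformly_compact[OF assms(1-3) \<Y>] cpt by blast
    obtain F where F: "finite F" "F \<subseteq> carrier \<Gamma>"
        and FW: "\<And>Y. Y \<in> \<Y> \<Longrightarrow> \<exists>g\<in>F. induced_action M \<phi> g Y \<in> W"
      using ind.minimal_covered_by_translates[OF compact_space_chabauty assms(5) W] by blast
    \<comment> \<open>If \<open>g\<close> moves \<open>Y\<close> into \<open>W\<close>, then
      \<open>K\<close> contains the translate of \<open>Y\<close> by \<open>g\<close>, so
      \<open>Y\<close> itself lies in the translate of \<open>K\<close> by the inverse of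
      \<open>g\<close>.\<close>
    define L where "L = (\<Union>g\<in>F. \<phi> (inv\<^bsub>\<Gamma>\<^esub> g) ` K)"
    have L: "compactin M L"
      unfolding L_def
    proof (rule compactin_Union)
      show "compactin M S" if S: "S \<in> (\<lambda>g. \<phi> (inv\<^bsub>\<Gamma>\<^esub> g) ` K) ` F" for S
      proof -
        obtain g where g: "g \<in> F" "S = \<phi> (inv\<^bsub>\<Gamma>\<^esub> g) ` K"
          using S by blast
        have "inv\<^bsub>\<Gamma>\<^esub> g \<in> carrier \<Gamma>"
          using subsetD[OF F(2) g(1)] by simp
        then show ?thesis
          unfolding g(2)
          by (rule image_compactin[OF K homeomorphic_imp_continuous_map[OF homeomorphic_map_action]])
      qed
    qed (use F in simp)
    have "\<Union>\<Y> \<subseteq> L"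
    proof clarify
      fix x Y
      assume x: "x \<in> Y" and Y: "Y \<in> \<Y>"
      obtain g where g: "g \<in> F" "g \<in> carrier \<Gamma>" "induced_action M \<phi> g Y \<in> W"
        using FW[OF Y] F(2) by blast
      moreover have "induced_action M \<phi> g Y \<in> \<Y>"
        using assms(5) g(2) Y by (auto simp: minimal_closed_invariant_def invariant_under_def)
      ultimately have "induced_action M \<phi> g Y \<subseteq> K"
        using WK by blast
      then have "\<phi> g x \<in> K"
        using x \<Y>closed[OF Y] by (auto simp: induced_action_def topspace_chabauty)
      moreover have "x = \<phi> (inv\<^bsub>\<Gamma>\<^esub> g) (\<phi> g x)"
        using x closedin_subset[OF \<Y>closed[OF Y]] by (auto simp: action_inverse(1)[OF g(2)])
      ultimately show "x \<in> L"
        using g(1) unfolding L_def by blast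
    qed
    \<comment> \<open>In a Hausdorff space the compact set \<open>L\<close> is closed, so it
      contains the closure as well.\<close>
    then have "M closure_of (\<Union>\<Y>) \<subseteq> L"
      using compactin_imp_closedin[OF assms(3) L] by (rule closure_of_minimal)
    then show "compactin M (M closure_of (\<Union>\<Y>))"
      by (rule closed_compactin[OF L _ closedin_closure_of])
  }
qed

end
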